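(* Let $k$ be a positive integer and let $H$ be an $n$-vertex directed graph that is $k$-critical. Then $|E(H)|=O(k^{1/2}n^{3/2})$.
   Context: For a directed graph $G$, $\mathrm{flow}(G,s,t)$ is the maximum number of pairwise edge-disjoint $s$-to-$t$ paths, $\lambda_G(s,t)=\min(\mathrm{flow}(G,s,t),\mathrm{flow}(G,t,s))$ and $\lambda^k_G(s,t)=\min(\lambda_G(s,t),k)$. A subgraph $H'$ of $H$ (same vertex set, subset of edges) is a $k$-connectivity preserver of $H$ if $\lambda^k_{H'}(s,t)=\lambda^k_H(s,t)$ for all $s,t\in V(H)$. A graph $H$ is $k$-critical if no subgraph $H'$ of $H$ with $E(H')\subsetneq E(H)$ is a $k$-connectivity preserver of $H$. *)

theory Defs
  imports Complex_Main "Graph_Theory.Graph_Theory"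
begin

definition edge_disjoint_paths ::
    "('a, 'b) pre_digraph \<Rightarrow> 'a \<Rightarrow> 'a \<Rightarrow> 'b awalk set \<Rightarrow> bool" where
  "edge_disjoint_paths G s t P \<longleftrightarrow>
     (\<forall>p\<in>P. pre_digraph.apath G s p t) \<and> pairwise (\<lambda>p q. set p \<inter> set q = {}) P"

text \<open>
  In a finite digraph there are only finitely many paths from \<open>s\<close> to \<open>t\<close>, so the maximum is over
  a finite set containing \<open>0\<close>. On the diagonal the empty path is the only path from \<open>s\<close> to \<open>s\<close>;
  hence \<open>flow G s s = 1\<close> for every vertex \<open>s\<close>, and the pairs \<open>s = t\<close> impose no condition on
  preservers.
\<close>

definition flow :: "('a, 'b) pre_digraph \<Rightarrow> 'a \<Rightarrow> 'a \<Rightarrow> nat" where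
  "flow G s t = Max {card P | P. edge_disjoint_paths G s t P}"

definition edge_conn :: "('a, 'b) pre_digraph \<Rightarrow> 'a \<Rightarrow> 'a \<Rightarrow> nat" where
  "edge_conn G s t = min (flow G s t) (flow G t s)"

definition edge_conn_upto :: "nat \<Rightarrow> ('a, 'b) pre_digraph \<Rightarrow> 'a \<Rightarrow> 'a \<Rightarrow> nat" where
  "edge_conn_upto k G s t = min (edge_conn G s t) k"

definition connectivity_preserver ::
    "nat \<Rightarrow> ('a, 'b) pre_digraph \<Rightarrow> ('a, 'b) pre_digraph \<Rightarrow> bool" where
  "connectivity_preserver k H' H \<longleftrightarrow>
     spanning H' H \<and>
     (\<forall>s\<in>verts H. \<forall>t\<in>verts H. edge_conn_upto k H' s t = edge_conn_upto k H s t)"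

definition critical :: "nat \<Rightarrow> ('a, 'b) pre_digraph \<Rightarrow> bool" where
  "critical k H \<longleftrightarrow> \<not> (\<exists>H'. arcs H' \<subset> arcs H \<and> connectivity_preserver k H' H)"

end

theory Submission
  imports Defs
begin

text \<open>
  Criticality and Menger's theorem give every arc \<open>e\<close> a cut \<open>S\<close> with \<open>e\<close> among its at most \<open>k\<close>
  leaving arcs, such that for some \<open>s \<in> S\<close> and \<open>t \<notin> S\<close> every set separating \<open>s\<close> and \<open>t\<close>, in either
  direction, has at least as many leaving arcs. Let \<open>F\<close> be a set of arcs in which all tails and
  heads have degree greater than \<open>D\<close>, where \<open>D\<close> is of order \<open>k + (k n)\<^sup>1\<^sup>/\<^sup>2\<close>. Among the sets \<open>P\<close>
  with few leaving arcs, but with many \<open>F\<close>-arcs from some vertex into \<open>P\<close> and many \<open>F\<close>-arcs to some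
  vertex from outside \<open>P\<close>, take one with the fewest leaving arcs. If an \<open>F\<close>-arc enters \<open>P\<close> and both
  its ends have more than \<open>k\<close> entering \<open>F\<close>-arcs, uncrossing \<open>P\<close> with the cut of that arc yields a
  smaller competitor. So \<open>P\<close> splits \<open>F\<close> into two parts at the cost of \<open>O(k n)\<close> arcs, and since the
  graph is simple both parts have at least \<open>D - k\<close> vertices. Repeatedly pruning vertices of degree
  at most \<open>D\<close> and splitting therefore removes at most \<open>O(n D + (n / D) k n)\<close> arcs.
\<close>

section \<open>Cuts and edge-disjoint paths\<close>

definition leaving :: "('a, 'b) pre_digraph \<Rightarrow> 'b set \<Rightarrow> 'a set \<Rightarrow> 'b set" where
  "leaving G A Z = {e \<in> A. tail G e \<in> Z \<and> head G e \<notin> Z}"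

lemma finite_leaving: "finite A \<Longrightarrow> finite (leaving G A Z)"
  by (simp add: leaving_def)

lemma card_Collect_eq_sum:
  assumes "finite A"
  shows "card {e \<in> A. Q e} = (\<Sum>e\<in>A. of_bool (Q e))"
  using assms by (simp add: Int_def)

text \<open>No arc counts more on the left than on the right. An arc from \<open>S - T\<close> to
  \<open>T - S\<close> leaves \<open>S\<close> but neither \<open>S \<inter> T\<close> nor
  \<open>S \<union> T\<close>, which makes room for the third term.\<close>

lemma card_leaving_submodular:
  assumes "finite A"
  shows "card (leaving G A (S \<inter> T)) + card (leaving G A (S \<union> T))
      + card {e \<in> A. tail G e \<in> S - T \<and> head G e \<in> T - S}
    \<le> card (leaving G A S) + card (leaving G A T)"
  unfolding leaving_def card_Collect_eq_sum[OF assms] sum.distrib[symmetric]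
  by (rule sum_mono) auto

text \<open>The crossings telescope along the walk. Entering arcs are those leaving
  \<open>- Z\<close>, and sums replace differences of natural numbers.\<close>

lemma (in pre_digraph) cas_net_leaving:
  assumes "cas u p v" "distinct p"
  shows "card (leaving G (set p) Z) + of_bool (v \<in> Z) =
    card (leaving G (set p) (- Z)) + of_bool (u \<in> Z)"
  using assms
proof (induction p arbitrary: u)
  case Nil
  then show ?case by (simp add: leaving_def)
next
  case (Cons e p)
  have "leaving G (set (e # p)) Y = (if tail G e \<in> Y \<and> head G e \<notin> Y
      then insert e (leaving G (set p) Y) else leaving G (set p) Y)" for Y
    by (auto simp: leaving_def)
  moreover have "e \<notin> leaving G (set p) Y" for Y using Cons.prems by (auto simp: leaving_def)
  ultimately show ?case
    using Cons.IH[of "head G e"] Cons.prems by (auto simp: finite_leaving)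
qed

lemma (in pre_digraph) apath_distinct:
  assumes "apath u p v"
  shows "distinct p"
  using assms by (auto simp: apath_def awalk_verts_conv distinct_map split: if_splits)

section \<open>Decomposing flows into paths\<close>

lemma card_leaving_Diff:
  assumes "finite A" "B \<subseteq> A"
  shows "card (leaving G A Z) = card (leaving G (A - B) Z) + card (leaving G B Z)"
proof -
  have "leaving G A Z = leaving G (A - B) Z \<union> leaving G B Z"
    "leaving G (A - B) Z \<inter> leaving G B Z = {}"
    using assms by (auto simp: leaving_def)
  then show ?thesis
    using assms by (simp add: card_Un_disjoint finite_leaving finite_subset)
qed

text \<open>The last assumption makes \<open>A\<close> a flow of value \<open>f\<close>, stated
  through cuts. Removing one path lowers every net crossing by one, so induction on \<open>f\<close>
  applies.\<close>

lemma (in wf_digraph) edge_disjoint_paths_of_net_leaving: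
  assumes "finite A" "A \<subseteq> arcs G" "s \<in> verts G" "s \<noteq> t"
    and "\<And>Z. s \<in> Z \<Longrightarrow> t \<notin> Z \<Longrightarrow> card (leaving G A Z) = card (leaving G A (- Z)) + f"
  shows "\<exists>P. edge_disjoint_paths G s t P \<and> finite P \<and> card P = f \<and> (\<forall>p\<in>P. set p \<subseteq> A)"
  using assms(1,2,5)
proof (induction f arbitrary: A)
  case 0
  show ?case by (rule exI[of _ "{}"]) (simp add: edge_disjoint_paths_def)
next
  case (Suc f)
  \<comment> \<open>No arc of \<open>A\<close> leaves the reachable set \<open>R\<close>, so with
    \<open>t\<close> outside \<open>R\<close> its net crossing could not be
    \<open>Suc f\<close>.\<close>
  define R where "R = {v. \<exists>p. awalk s p v \<and> set p \<subseteq> A}"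
  have "awalk s [] s" using assms(3) by (simp add: awalk_simps)
  then have "s \<in> R" by (force simp: R_def)
  moreover have "leaving G A R = {}"
  proof (rule ccontr)
    assume "leaving G A R \<noteq> {}"
    then obtain e where e: "e \<in> A" "tail G e \<in> R" "head G e \<notin> R" by (auto simp: leaving_def)
    then obtain p where p: "awalk s p (tail G e)" "set p \<subseteq> A" by (auto simp: R_def)
    have "awalk s (p @ [e]) (head G e)"
      using p e Suc.prems(2) by (intro awalk_appendI[OF p(1)] arc_implies_awalk) auto
    moreover have "set (p @ [e]) \<subseteq> A" using p e by simp
    ultimately show False using e(3) by (auto simp only: R_def mem_Collect_eq)
  qed
  ultimately have "t \<in> R" using Suc.prems(3)[of R] by fastforce
  then obtain w where w: "awalk s w t" "set w \<subseteq> A" by (auto simp: R_def)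
  define p where "p = awalk_to_apath w"
  have p: "apath s p t" "set p \<subseteq> A"
    using apath_awalk_to_apath[OF w(1)] awalk_to_apath_subset[OF w(1)] w(2) by (auto simp: p_def)
  have "p \<noteq> []" using p(1) assms(4) by (auto simp: apath_simps)
  have "card (leaving G (A - set p) Z) = card (leaving G (A - set p) (- Z)) + f"
    if "s \<in> Z" "t \<notin> Z" for Z
  proof -
    have "cas s p t" using p(1) by (simp add: apath_def awalk_def)
    then have "card (leaving G (set p) Z) = card (leaving G (set p) (- Z)) + 1"
      using cas_net_leaving[of s p t Z] apath_distinct[OF p(1)] that by simp
    then show ?thesis
      using card_leaving_Diff[OF Suc.prems(1) p(2), of G Z]
        card_leaving_Diff[OF Suc.prems(1) p(2), of G "- Z"] Suc.prems(3)[OF that] by linarith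
  qed
  then obtain P where P: "edge_disjoint_paths G s t P" "finite P" "card P = f"
    "\<forall>q\<in>P. set q \<subseteq> A - set p"
    using Suc.IH[of "A - set p"] Suc.prems(1,2) by blast
  have "p \<notin> P"
  proof
    assume "p \<in> P"
    then have "set p \<subseteq> A - set p" using P(4) by blast
    moreover have "hd p \<in> set p" using \<open>p \<noteq> []\<close> by simp
    ultimately show False by blast
  qed
  moreover have "edge_disjoint_paths G s t (insert p P)"
    using P(1,4) p(1) by (auto simp: edge_disjoint_paths_def pairwise_insert)
  ultimately show ?case using P p(2) by (intro exI[of _ "insert p P"]) auto
qed

section \<open>From cut bounds to a flow\<close>

lemma card_leaving_eq_degree_sum:
  fixes G :: "('a, 'b) pre_digraph"
  assumes "finite A" "finite Z"
  shows "card (leaving G A Z) + (\<Sum>v\<in>Z. card {e \<in> A. head G e = v}) =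
    card (leaving G A (- Z)) + (\<Sum>v\<in>Z. card {e \<in> A. tail G e = v})"
proof -
  have sum: "(\<Sum>v\<in>Z. card {e \<in> A. g e = v}) = card {e \<in> A. g e \<in> Z}" for g :: "'b \<Rightarrow> 'a"
  proof -
    have "{e \<in> A. g e \<in> Z} = (\<Union>v\<in>Z. {e \<in> A. g e = v})" by auto
    then show ?thesis using assms by (simp, subst card_UN_disjoint) auto
  qed
  let ?I = "{e \<in> A. tail G e \<in> Z \<and> head G e \<in> Z}"
  have "{e \<in> A. head G e \<in> Z} = leaving G A (- Z) \<union> ?I" "leaving G A (- Z) \<inter> ?I = {}"
    "{e \<in> A. tail G e \<in> Z} = leaving G A Z \<union> ?I" "leaving G A Z \<inter> ?I = {}"
    by (auto simp: leaving_def)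
  then have "card {e \<in> A. head G e \<in> Z} = card (leaving G A (- Z)) + card ?I"
    "card {e \<in> A. tail G e \<in> Z} = card (leaving G A Z) + card ?I"
    using assms by (simp_all add: card_Un_disjoint finite_leaving)
  then show ?thesis unfolding sum by simp
qed

text \<open>
  A minimal set of arcs whose \<open>s\<close>-\<open>t\<close> cuts all have size at least \<open>f\<close> is already a flow of value
  \<open>f\<close>: each of its arcs leaves a cut of size exactly \<open>f\<close>, and these cuts are closed under
  intersection and union.
\<close>

lemma (in fin_digraph) net_leaving_of_cuts:
  assumes st: "s \<in> verts G" "t \<in> verts G" "s \<noteq> t"
    and cuts: "\<And>Z. s \<in> Z \<Longrightarrow> t \<notin> Z \<Longrightarrow> f \<le> card (leaving G (arcs G) Z)"
  obtains A where "A \<subseteq> arcs G"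
    and "\<And>Z. s \<in> Z \<Longrightarrow> t \<notin> Z \<Longrightarrow> card (leaving G A Z) = card (leaving G A (- Z)) + f"
proof -
  define C where "C A \<longleftrightarrow> A \<subseteq> arcs G \<and>
    (\<forall>Z. s \<in> Z \<longrightarrow> t \<notin> Z \<longrightarrow> f \<le> card (leaving G A Z))" for A
  have "C (arcs G)" using cuts by (simp add: C_def)
  then obtain A where A: "C A" and A_min: "\<And>B. C B \<Longrightarrow> card A \<le> card B"
    using ex_has_least_nat[of C "arcs G" card] by blast
  have sub: "A \<subseteq> arcs G" and ge: "\<And>Z. s \<in> Z \<Longrightarrow> t \<notin> Z \<Longrightarrow> f \<le> card (leaving G A Z)"
    using A by (auto simp: C_def)
  have finA: "finite A" using sub finite_arcs finite_subset by blast
  \<comment> \<open>A cut depends only on \<open>Z \<inter> verts G\<close>, so tight sets can be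
    taken finite and extremal ones exist.\<close>
  have inter: "leaving G A (Z \<inter> verts G) = leaving G A Z"
    "leaving G A (- (Z \<inter> verts G)) = leaving G A (- Z)" for Z
    using sub by (auto simp: leaving_def)
  define tight where "tight Z \<longleftrightarrow> Z \<subseteq> verts G \<and> s \<in> Z \<and> t \<notin> Z \<and> card (leaving G A Z) = f" for Z
  have fin_tight: "finite Z" if "tight Z" for Z
    using that finite_verts by (auto simp: tight_def intro: finite_subset)
  have tight_ex: "\<exists>Z. tight Z \<and> e \<in> leaving G A Z" if e: "e \<in> A" for e
  proof -
    have "\<not> C (A - {e})" using A_min[of "A - {e}"] card_Diff1_less[OF finA e] by linarith
    then obtain Z where Z: "s \<in> Z" "t \<notin> Z" "card (leaving G (A - {e}) Z) < f"
      using sub by (auto simp: C_def not_le)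
    have eq: "leaving G (A - {e}) Z = leaving G A Z - {e}" by (auto simp: leaving_def)
    have "e \<in> leaving G A Z" using Z ge[of Z] eq by (metis Diff_empty Diff_insert0 not_le)
    moreover have "card (leaving G A Z) = f"
      using Z(3) ge[OF Z(1,2)] eq calculation finite_leaving[OF finA, of G Z]
      by (simp add: card_Diff_singleton)
    ultimately show ?thesis
      using Z st inter by (intro exI[of _ "Z \<inter> verts G"]) (auto simp: tight_def)
  qed
  have uncross: "tight (S \<inter> T)" "tight (S \<union> T)"
    "{e \<in> A. tail G e \<in> S - T \<and> head G e \<in> T - S} = {}" if "tight S" "tight T" for S T
  proof -
    have "f \<le> card (leaving G A (S \<inter> T))" "f \<le> card (leaving G A (S \<union> T))"
      using that by (intro ge; auto simp: tight_def)+
    moreover note card_leaving_submodular[OF finA, of G S T]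
    ultimately have "card (leaving G A (S \<inter> T)) = f" "card (leaving G A (S \<union> T)) = f"
      "card {e \<in> A. tail G e \<in> S - T \<and> head G e \<in> T - S} = 0"
      using that by (auto simp: tight_def)
    then show "tight (S \<inter> T)" "tight (S \<union> T)"
      "{e \<in> A. tail G e \<in> S - T \<and> head G e \<in> T - S} = {}"
      using that finA by (auto simp: tight_def)
  qed
  \<comment> \<open>An arc entering \<open>S\<close> would leave some tight \<open>T\<close>, hence
    run from \<open>T - S\<close> to \<open>S - T\<close>, which uncrossing forbids.\<close>
  have no_enter: "leaving G A (- S) = {}" if S: "tight S" for S
  proof (rule ccontr)
    assume "leaving G A (- S) \<noteq> {}"
    then obtain e where e: "e \<in> A" "tail G e \<notin> S" "head G e \<in> S" by (auto simp: leaving_def)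
    then obtain T where T: "tight T" "e \<in> leaving G A T" using tight_ex by blast
    then show False using uncross(3)[OF T(1) S] e by (auto simp: leaving_def)
  qed
  let ?in = "\<lambda>v. {e \<in> A. head G e = v}" and ?out = "\<lambda>v. {e \<in> A. tail G e = v}"
  \<comment> \<open>Every arc into \<open>v\<close> leaves a largest tight set avoiding
    \<open>v\<close>. Adding \<open>v\<close> to that set trades these arcs for at most the arcs out
    of \<open>v\<close>, and the cut may not drop below \<open>f\<close>.\<close>
  have in_le_out: "card (?in v) \<le> card (?out v)" if v: "v \<in> verts G" "v \<noteq> s" "v \<noteq> t" for v
  proof (cases "?in v = {}")
    case True
    then show ?thesis by (metis card.empty le0)
  next
    case False
    then obtain S0 where S0: "tight S0" "v \<notin> S0" using tight_ex by (fastforce simp: leaving_def)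
    have "\<forall>S. tight S \<and> v \<notin> S \<longrightarrow> card S < Suc (card (verts G))"
      using card_mono[OF finite_verts] by (auto simp: tight_def less_Suc_eq_le)
    from ex_has_greatest_nat[of "\<lambda>S. tight S \<and> v \<notin> S", OF conjI[OF S0] this]
    obtain S where S: "tight S" "v \<notin> S" and max: "\<And>T. tight T \<Longrightarrow> v \<notin> T \<Longrightarrow> card T \<le> card S"
      by blast
    have "?in v \<subseteq> leaving G A S"
    proof
      fix e assume e: "e \<in> ?in v"
      then obtain T where T: "tight T" "e \<in> leaving G A T" using tight_ex by blast
      then have "v \<notin> T" using e by (auto simp: leaving_def)
      then have "card (S \<union> T) \<le> card S" using max uncross(2)[OF S(1) T(1)] S(2) by blast
      then have "S \<union> T = S"
        using fin_tight[OF uncross(2)[OF S(1) T(1)]] by (metis Un_upper1 card_seteq)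
      then show "e \<in> leaving G A S" using T(2) e S(2) by (auto simp: leaving_def)
    qed
    moreover have "leaving G A (insert v S) \<subseteq> (leaving G A S - ?in v) \<union> ?out v"
      by (auto simp: leaving_def)
    then have "card (leaving G A (insert v S)) \<le> card ((leaving G A S - ?in v) \<union> ?out v)"
      using finA finite_leaving[OF finA] by (intro card_mono) auto
    then have "card (leaving G A (insert v S)) \<le> card (leaving G A S - ?in v) + card (?out v)"
      by (rule order_trans) (rule card_Un_le)
    moreover have "f \<le> card (leaving G A (insert v S))" using S v by (intro ge) (auto simp: tight_def)
    moreover have "card (leaving G A S) = f" using S by (simp add: tight_def)
    ultimately show ?thesis
      using card_Diff_subset[of "?in v" "leaving G A S"] card_mono[OF finite_leaving[OF finA], of "?in v" G S]
        finA by simp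
  qed
  \<comment> \<open>Dually, \<open>v\<close> is removed from a smallest tight set containing
    it.\<close>
  have out_le_in: "card (?out v) \<le> card (?in v)" if v: "v \<in> verts G" "v \<noteq> s" "v \<noteq> t" for v
  proof (cases "?out v = {}")
    case True
    then show ?thesis by (metis card.empty le0)
  next
    case False
    then obtain S0 where S0: "tight S0 \<and> v \<in> S0" using tight_ex by (fastforce simp: leaving_def)
    from ex_has_least_nat[of "\<lambda>S. tight S \<and> v \<in> S", OF this, of card]
    obtain S where S: "tight S" "v \<in> S" and min: "\<And>T. tight T \<Longrightarrow> v \<in> T \<Longrightarrow> card S \<le> card T"
      by blast
    have "?out v \<subseteq> leaving G A S"
    proof
      fix e assume e: "e \<in> ?out v"
      then obtain T where T: "tight T" "e \<in> leaving G A T" using tight_ex by blast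
      then have "v \<in> T" using e by (auto simp: leaving_def)
      then have "card S \<le> card (S \<inter> T)" using min uncross(1)[OF S(1) T(1)] S(2) by blast
      then have "S \<inter> T = S"
        using fin_tight[OF S(1)] by (metis Int_lower1 card_seteq)
      then show "e \<in> leaving G A S" using T(2) e S(2) by (auto simp: leaving_def)
    qed
    moreover have "leaving G A (S - {v}) \<subseteq> (leaving G A S - ?out v) \<union> ?in v"
      by (auto simp: leaving_def)
    then have "card (leaving G A (S - {v})) \<le> card ((leaving G A S - ?out v) \<union> ?in v)"
      using finA finite_leaving[OF finA] by (intro card_mono) auto
    then have "card (leaving G A (S - {v})) \<le> card (leaving G A S - ?out v) + card (?in v)"
      by (rule order_trans) (rule card_Un_le)
    moreover have "f \<le> card (leaving G A (S - {v}))" using S v by (intro ge) (auto simp: tight_def)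
    moreover have "card (leaving G A S) = f" using S by (simp add: tight_def)
    ultimately show ?thesis
      using card_Diff_subset[of "?out v" "leaving G A S"] card_mono[OF finite_leaving[OF finA], of "?out v" G S]
        finA by simp
  qed
  \<comment> \<open>Balance at all vertices other than \<open>s\<close> and \<open>t\<close> gives
    every \<open>s\<close>-\<open>t\<close> cut the net crossing of \<open>s\<close> alone.\<close>
  have conserve: "card (leaving G A Z) + card (?in s) = card (leaving G A (- Z)) + card (?out s)"
    if Z: "s \<in> Z" "t \<notin> Z" for Z
  proof -
    let ?Z = "Z \<inter> verts G"
    have "(\<Sum>v\<in>?Z - {s}. card (?in v)) = (\<Sum>v\<in>?Z - {s}. card (?out v))"
      using in_le_out out_le_in Z by (intro sum.cong refl antisym) auto
    moreover have "(\<Sum>v\<in>?Z. g v) = g s + (\<Sum>v\<in>?Z - {s}. g v)" for g :: "'a \<Rightarrow> nat"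
      using Z st by (intro sum.remove) auto
    ultimately show ?thesis
      using card_leaving_eq_degree_sum[OF finA, of ?Z G] unfolding inter by simp
  qed
  \<comment> \<open>A tight cut without entering arcs shows that the common value is
    \<open>f\<close>. If \<open>A\<close> is empty, \<open>tight_ex\<close> yields none, but
    \<open>ge\<close> forces \<open>f = 0\<close>.\<close>
  have "card (leaving G A Z) = card (leaving G A (- Z)) + f" if Z: "s \<in> Z" "t \<notin> Z" for Z
  proof (cases "A = {}")
    case True
    then show ?thesis using ge[OF Z] by (simp add: leaving_def)
  next
    case False
    then obtain S where S: "tight S" using tight_ex by blast
    then have "s \<in> S" "t \<notin> S" "card (leaving G A S) = f" by (auto simp: tight_def)
    then show ?thesis using conserve[of S] conserve[OF Z] no_enter[OF S] by simp
  qed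
  then show thesis using that sub by blast
qed

section \<open>Menger's theorem for \<open>flow\<close>\<close>

lemma (in fin_digraph) finite_edge_disjoint_paths:
  shows "finite {P. edge_disjoint_paths G s t P}"
proof -
  have "{P. edge_disjoint_paths G s t P} \<subseteq> Pow {p. apath s p t}"
    by (auto simp: edge_disjoint_paths_def)
  then show ?thesis by (rule finite_subset) (simp add: apaths_finite)
qed

lemma (in fin_digraph) card_le_flow:
  assumes "edge_disjoint_paths G s t P"
  shows "card P \<le> flow G s t"
  using assms finite_edge_disjoint_paths[of s t] unfolding flow_def by (intro Max_ge) auto

lemma (in fin_digraph) flow_attained:
  obtains P where "edge_disjoint_paths G s t P" "card P = flow G s t"
proof -
  have "edge_disjoint_paths G s t {}" by (simp add: edge_disjoint_paths_def)
  then have "flow G s t \<in> {card P | P. edge_disjoint_paths G s t P}"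
    using finite_edge_disjoint_paths[of s t] unfolding flow_def by (intro Max_in) auto
  then show thesis using that by auto
qed

text \<open>Each path uses an arc leaving \<open>Z\<close>, and disjoint paths use different
  ones.\<close>

lemma (in fin_digraph) flow_le_cut:
  assumes "s \<in> Z" "t \<notin> Z"
  shows "flow G s t \<le> card (leaving G (arcs G) Z)"
proof -
  obtain P where P: "edge_disjoint_paths G s t P" "card P = flow G s t" by (rule flow_attained)
  have "\<exists>e. e \<in> set p \<inter> leaving G (arcs G) Z" if "p \<in> P" for p
  proof -
    have p: "apath s p t" using P that by (simp add: edge_disjoint_paths_def)
    then have "cas s p t" "set p \<subseteq> arcs G" by (auto simp: apath_def awalk_def)
    then have "card (leaving G (set p) Z) \<noteq> 0"
      using cas_net_leaving[of s p t Z] apath_distinct[OF p] assms by simp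
    then have "leaving G (set p) Z \<noteq> {}" by auto
    then show ?thesis using \<open>set p \<subseteq> arcs G\<close> by (auto simp: leaving_def)
  qed
  then obtain g where g: "\<And>p. p \<in> P \<Longrightarrow> g p \<in> set p \<inter> leaving G (arcs G) Z" by metis
  have "inj_on g P"
  proof (rule inj_onI, rule ccontr)
    fix p q assume pq: "p \<in> P" "q \<in> P" "g p = g q" "p \<noteq> q"
    then have "set p \<inter> set q = {}" using P(1) by (auto simp: edge_disjoint_paths_def pairwise_def)
    then show False using g[OF pq(1)] g[OF pq(2)] pq(3) by auto
  qed
  then have "card P \<le> card (leaving G (arcs G) Z)"
    using g finite_leaving[OF finite_arcs] by (intro card_inj_on_le[of g]) auto
  then show ?thesis using P by simp
qed

text \<open>If every cut exceeded the flow, a flow of value one more would exist and decompose into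
  too many paths.\<close>

lemma (in fin_digraph) ex_cut_le_flow:
  assumes "s \<in> verts G" "t \<in> verts G" "s \<noteq> t"
  obtains Z where "s \<in> Z" "t \<notin> Z" "card (leaving G (arcs G) Z) \<le> flow G s t"
proof (rule ccontr)
  assume "\<not> thesis"
  then have "flow G s t + 1 \<le> card (leaving G (arcs G) Z)" if "s \<in> Z" "t \<notin> Z" for Z
    using that \<open>\<And>Z. s \<in> Z \<Longrightarrow> t \<notin> Z \<Longrightarrow> card (leaving G (arcs G) Z) \<le> flow G s t \<Longrightarrow> thesis\<close> by force
  from net_leaving_of_cuts[OF assms this] obtain A where A: "A \<subseteq> arcs G"
    "\<And>Z. s \<in> Z \<Longrightarrow> t \<notin> Z \<Longrightarrow> card (leaving G A Z) = card (leaving G A (- Z)) + (flow G s t + 1)"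
    by blast
  have "finite A" using A(1) finite_arcs finite_subset by blast
  from edge_disjoint_paths_of_net_leaving[OF this A(1) assms(1,3) A(2)]
  obtain P where "edge_disjoint_paths G s t P" "card P = flow G s t + 1" by blast
  then show False using card_le_flow by fastforce
qed

lemma (in fin_digraph) flow_refl:
  assumes "s \<in> verts G"
  shows "flow G s s = 1"
proof -
  obtain P where P: "edge_disjoint_paths G s s P" "card P = flow G s s" by (rule flow_attained)
  have "p = []" if "p \<in> P" for p
    using that P(1) apath_nonempty_ends[of s p s] by (auto simp: edge_disjoint_paths_def)
  then have "P \<subseteq> {[]}" by auto
  from card_mono[OF _ this] have "flow G s s \<le> 1" using P(2) by simp
  moreover have "edge_disjoint_paths G s s {[]}"
    using assms by (simp add: edge_disjoint_paths_def apath_simps)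
  then have "1 \<le> flow G s s" using card_le_flow by fastforce
  ultimately show ?thesis by simp
qed

section \<open>Sets of arcs with tight cuts\<close>

text \<open>
  The set \<open>S\<close> witnesses that the arc \<open>e\<close> cannot be deleted. Since \<open>\<lambda>\<close> is a minimum over both
  directions, \<open>S\<close> is also no larger than the cuts that separate \<open>t\<close> from \<open>s\<close>.
\<close>

definition tight_cut :: "('a, 'b) pre_digraph \<Rightarrow> nat \<Rightarrow> 'b \<Rightarrow> 'a set \<Rightarrow> bool" where
  "tight_cut G k e S \<longleftrightarrow> e \<in> leaving G (arcs G) S \<and> card (leaving G (arcs G) S) \<le> k \<and>
     (\<exists>s t. s \<in> S \<and> t \<notin> S \<and>
        (\<forall>Z. (s \<in> Z) \<noteq> (t \<in> Z) \<longrightarrow> card (leaving G (arcs G) S) \<le> card (leaving G (arcs G) Z)))"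

text \<open>Submodularity bounds the two new cuts together. If \<open>s \<in> P\<close> or
  \<open>t \<notin> P\<close>, one of them separates \<open>s\<close> from \<open>t\<close> and is
  at least as large as the cut of \<open>S\<close>, so the other takes the whole gain. Otherwise
  \<open>P\<close> separates \<open>t\<close> from \<open>s\<close>, its cut is at least that of
  \<open>S\<close>, and the gain is shared between \<open>out\<close> and
  \<open>inn\<close>.\<close>

lemma tight_cut_uncross:
  assumes fin: "finite (arcs G)" and inj: "inj_on (arc_to_ends G) (arcs G)"
    and tight: "tight_cut G k e S" and F: "F \<subseteq> arcs G" "e \<in> F"
    and e: "tail G e \<notin> P" "head G e \<in> P"
  defines "out \<equiv> {f \<in> F. tail G f = tail G e \<and> head G f \<in> P - S}"
    and "inn \<equiv> {f \<in> F. head G f = head G e \<and> tail G f \<in> S - P}"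
  shows "card (leaving G (arcs G) (P \<inter> S)) + card out \<le> card (leaving G (arcs G) P) \<or>
    card (leaving G (arcs G) (P \<union> S)) + card inn \<le> card (leaving G (arcs G) P)"
    (is "?d (P \<inter> S) + _ \<le> _ \<or> _")
proof -
  obtain s t where st: "s \<in> S" "t \<notin> S" "\<And>Z. (s \<in> Z) \<noteq> (t \<in> Z) \<Longrightarrow> ?d S \<le> ?d Z"
    and eS: "tail G e \<in> S" "head G e \<notin> S"
    using tight by (auto simp: tight_cut_def leaving_def)
  define c where "c = {f \<in> arcs G. tail G f \<in> S - P \<and> head G f \<in> P - S}"
  have sub: "?d (P \<inter> S) + ?d (P \<union> S) + card c \<le> ?d P + ?d S"
    using card_leaving_submodular[OF fin, of G S P] by (simp add: c_def Int_commute Un_commute)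
  have finc: "finite c" using fin by (simp add: c_def)
  have oc: "out \<subseteq> c" and ic: "inn \<subseteq> c"
    using F e eS by (auto simp: c_def out_def inn_def)
  have "e \<in> out" "e \<in> inn" using F e eS by (auto simp: out_def inn_def)
  \<comment> \<open>A common arc has the same ends as \<open>e\<close>, hence is \<open>e\<close>.
    The resulting extra 1 is affordable: if both alternatives failed, they would fail by at least 2
    together.\<close>
  then have "out \<inter> inn = {e}"
    using F by (auto simp: out_def inn_def arc_to_ends_def intro!: inj_onD[OF inj])
  then have both: "card out + card inn \<le> card c + 1"
    using card_Un_Int[of out inn] card_mono[OF finc, of "out \<union> inn"] oc ic finite_subset[OF _ finc]
    by simp
  have le: "card out \<le> card c" "card inn \<le> card c"
    using oc ic finc by (auto intro: card_mono)
  consider "s \<in> P" | "t \<notin> P" | "s \<notin> P" "t \<in> P" by blast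
  then show ?thesis
  proof cases
    case 1
    then have "?d S \<le> ?d (P \<inter> S)" using st by auto
    with sub le show ?thesis by linarith
  next
    case 2
    then have "?d S \<le> ?d (P \<union> S)" using st by auto
    with sub le show ?thesis by linarith
  next
    case 3
    then have "?d S \<le> ?d P" using st by auto
    with sub both show ?thesis by linarith
  qed
qed

section \<open>Sparse splits of arc sets\<close>

text \<open>
  Using the value of the cut as the threshold in \<open>W\<close> is what makes \<open>W\<close> survive uncrossing: an
  intersection or union that loses \<open>l\<close> arcs of \<open>out\<close> or \<open>inn\<close> also loses \<open>l\<close> leaving arcs.
\<close>

lemma sparse_split:
  assumes fin: "finite (arcs G)" and inj: "inj_on (arc_to_ends G) (arcs G)"
    and F: "F \<subseteq> arcs G" "F \<noteq> {}" and tight: "\<And>e. e \<in> F \<Longrightarrow> \<exists>S. tight_cut G k e S"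
    and deg_tail: "\<And>e. e \<in> F \<Longrightarrow> 2 * k < card {f \<in> F. tail G f = tail G e}"
    and deg_head: "\<And>e. e \<in> F \<Longrightarrow> 2 * k < card {f \<in> F. head G f = head G e}"
  obtains P where "card (leaving G F P) \<le> k"
    and "card (leaving G F (- P)) \<le> k * (card (tail G ` F) + card (head G ` F))"
    and "\<exists>e\<in>F. tail G e \<in> P" and "\<exists>e\<in>F. head G e \<notin> P"
proof -
  let ?d = "\<lambda>Z. card (leaving G (arcs G) Z)"
  define out where "out x Z = {f \<in> F. tail G f = x \<and> head G f \<in> Z}" for x Z
  define inn where "inn y Z = {f \<in> F. head G f = y \<and> tail G f \<notin> Z}" for y Z
  define W where "W Z \<longleftrightarrow> (\<exists>x. ?d Z < card (out x Z)) \<and> (\<exists>y. ?d Z < card (inn y Z))" for Z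
  have finF: "finite F" using F fin finite_subset by blast
  then have fin_out: "finite (out x Z)" and fin_inn: "finite (inn y Z)" for x y Z
    by (simp_all add: out_def inn_def)
  have finL: "finite (leaving G (arcs G) Z)" for Z using fin by (rule finite_leaving)
  \<comment> \<open>Of the more than \<open>2 * k\<close> arcs of \<open>F\<close> at either end of
    \<open>e\<close>, at most \<open>k\<close> leave \<open>S\<close>, so more than \<open>k\<close>
    remain to beat the threshold \<open>?d S\<close>.\<close>
  have W_tight: "W S" and d_tight: "?d S \<le> k" if "tight_cut G k e S" "e \<in> F" for e S
  proof -
    have e: "tail G e \<in> S" "head G e \<notin> S" and dS: "?d S \<le> k"
      using that by (auto simp: tight_cut_def leaving_def)
    show "?d S \<le> k" by (rule dS)
    have "{f \<in> F. tail G f = tail G e} \<subseteq> out (tail G e) S \<union> leaving G (arcs G) S"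
      using e F by (auto simp: out_def leaving_def)
    from card_mono[OF _ this] have "card {f \<in> F. tail G f = tail G e} \<le> card (out (tail G e) S) + ?d S"
      using card_Un_le[of "out (tail G e) S" "leaving G (arcs G) S"] fin_out finL by fastforce
    then have 1: "?d S < card (out (tail G e) S)" using deg_tail[OF that(2)] dS by linarith
    have "{f \<in> F. head G f = head G e} \<subseteq> inn (head G e) S \<union> leaving G (arcs G) S"
      using e F by (auto simp: inn_def leaving_def)
    from card_mono[OF _ this] have "card {f \<in> F. head G f = head G e} \<le> card (inn (head G e) S) + ?d S"
      using card_Un_le[of "inn (head G e) S" "leaving G (arcs G) S"] fin_inn finL by fastforce
    then have 2: "?d S < card (inn (head G e) S)" using deg_head[OF that(2)] dS by linarith
    show "W S" unfolding W_def using 1 2 by blast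
  qed
  obtain e0 S0 where e0: "e0 \<in> F" and S0: "tight_cut G k e0 S0" using F(2) tight by blast
  obtain P where WP: "W P" and P_min: "\<And>Z. W Z \<Longrightarrow> ?d P \<le> ?d Z"
    using ex_has_least_nat[of W S0 ?d] W_tight[OF S0 e0] by blast
  have dP: "?d P \<le> k" using P_min[OF W_tight[OF S0 e0]] d_tight[OF S0 e0] by linarith
  \<comment> \<open>If both ends exceeded the threshold, uncrossing \<open>P\<close> with the tight
    cut of \<open>e\<close> would preserve \<open>W\<close> and shrink the cut strictly, since
    \<open>e\<close> itself lies in \<open>?o\<close> and \<open>?i\<close>.\<close>
  have key: "card (out (tail G e) P) \<le> ?d P \<or> card (inn (head G e) P) \<le> ?d P"
    if e: "e \<in> F" "tail G e \<notin> P" "head G e \<in> P" for e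
  proof (rule ccontr)
    let ?x = "tail G e" and ?y = "head G e"
    assume "\<not> ?thesis"
    then have big: "?d P < card (out ?x P)" "?d P < card (inn ?y P)" by auto
    obtain S where S: "tight_cut G k e S" using tight e by blast
    have eS: "?x \<in> S" "?y \<notin> S" using S by (auto simp: tight_cut_def leaving_def)
    let ?o = "{f \<in> F. tail G f = ?x \<and> head G f \<in> P - S}"
    let ?i = "{f \<in> F. head G f = ?y \<and> tail G f \<in> S - P}"
    have pos: "card ?o > 0" "card ?i > 0"
      using e eS finF by (auto simp: card_gt_0_iff)
    consider "?d (P \<inter> S) + card ?o \<le> ?d P" | "?d (P \<union> S) + card ?i \<le> ?d P"
      using tight_cut_uncross[OF fin inj S F(1) e(1) e(2,3)] by blast
    then show False
    proof cases
      case 1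
      have "out ?x P = out ?x (P \<inter> S) \<union> ?o" by (auto simp: out_def)
      then have "card (out ?x P) \<le> card (out ?x (P \<inter> S)) + card ?o" by (simp add: card_Un_le)
      then have a: "?d (P \<inter> S) < card (out ?x (P \<inter> S))" using 1 big by linarith
      have "inn ?y P \<subseteq> inn ?y (P \<inter> S)" by (auto simp: inn_def)
      from card_mono[OF fin_inn this] have b: "?d (P \<inter> S) < card (inn ?y (P \<inter> S))"
        using 1 big by linarith
      have "W (P \<inter> S)" unfolding W_def using a b by blast
      from P_min[OF this] show False using 1 pos by linarith
    next
      case 2
      have "inn ?y P = inn ?y (P \<union> S) \<union> ?i" by (auto simp: inn_def)
      then have "card (inn ?y P) \<le> card (inn ?y (P \<union> S)) + card ?i" by (simp add: card_Un_le)
      then have a: "?d (P \<union> S) < card (inn ?y (P \<union> S))" using 2 big by linarith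
      have "out ?x P \<subseteq> out ?x (P \<union> S)" by (auto simp: out_def)
      from card_mono[OF fin_out this] have b: "?d (P \<union> S) < card (out ?x (P \<union> S))"
        using 2 big by linarith
      have "W (P \<union> S)" unfolding W_def using a b by blast
      from P_min[OF this] show False using 2 pos by linarith
    qed
  qed
  have "leaving G F P \<subseteq> leaving G (arcs G) P" using F by (auto simp: leaving_def)
  from card_mono[OF finL this] have leave: "card (leaving G F P) \<le> k" using dP by linarith
  \<comment> \<open>Each arc entering \<open>P\<close> is charged to a tail in \<open>L\<close> or a
    head in \<open>R\<close>, each of which receives at most \<open>k\<close> charges.\<close>
  define L where "L = {x \<in> tail G ` F. x \<notin> P \<and> card (out x P) \<le> k}"
  define R where "R = {y \<in> head G ` F. y \<in> P \<and> card (inn y P) \<le> k}"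
  have LR: "finite L" "finite R" "card L \<le> card (tail G ` F)" "card R \<le> card (head G ` F)"
    using finF by (auto simp: L_def R_def intro: card_mono)
  have "leaving G F (- P) \<subseteq> (\<Union>x\<in>L. out x P) \<union> (\<Union>y\<in>R. inn y P)"
  proof
    fix e assume "e \<in> leaving G F (- P)"
    then have e: "e \<in> F" "tail G e \<notin> P" "head G e \<in> P" by (auto simp: leaving_def)
    then have "tail G e \<in> L \<or> head G e \<in> R" using key[OF e] dP by (auto simp: L_def R_def)
    moreover have "e \<in> out (tail G e) P" "e \<in> inn (head G e) P"
      using e by (auto simp: out_def inn_def)
    ultimately show "e \<in> (\<Union>x\<in>L. out x P) \<union> (\<Union>y\<in>R. inn y P)" by blast
  qed
  from card_mono[OF _ this]
  have "card (leaving G F (- P)) \<le> card ((\<Union>x\<in>L. out x P) \<union> (\<Union>y\<in>R. inn y P))"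
    using LR fin_out fin_inn by blast
  also have "\<dots> \<le> card (\<Union>x\<in>L. out x P) + card (\<Union>y\<in>R. inn y P)" by (rule card_Un_le)
  also have "card (\<Union>x\<in>L. out x P) \<le> (\<Sum>x\<in>L. card (out x P))" by (rule card_UN_le[OF LR(1)])
  also have "\<dots> \<le> card L * k" using sum_bounded_above[of L "\<lambda>x. card (out x P)" k] by (simp add: L_def)
  also have "card (\<Union>y\<in>R. inn y P) \<le> (\<Sum>y\<in>R. card (inn y P))" by (rule card_UN_le[OF LR(2)])
  also have "\<dots> \<le> card R * k" using sum_bounded_above[of R "\<lambda>y. card (inn y P)" k] by (simp add: R_def)
  also have "card L * k + card R * k \<le> k * (card (tail G ` F) + card (head G ` F))"
    using mult_le_mono2[OF add_mono[OF LR(3,4)], of k] by (simp add: algebra_simps)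
  finally have enter: "card (leaving G F (- P)) \<le> k * (card (tail G ` F) + card (head G ` F))"
    by simp
  have "\<exists>e\<in>F. tail G e \<in> P"
  proof -
    obtain x where x: "?d P < card (out x P)" using WP by (auto simp: W_def)
    then have "out x P \<noteq> {}" by auto
    then obtain e where e: "e \<in> F" "tail G e = x" "head G e \<in> P" by (auto simp: out_def)
    show ?thesis
    proof (rule ccontr)
      \<comment> \<open>Now all arcs of \<open>F\<close> into \<open>head G e\<close> come from
        outside \<open>P\<close>, so both ends of \<open>e\<close> exceed the threshold, against
        \<open>key\<close>.\<close>
      assume no: "\<not> ?thesis"
      then have "inn (head G e) P = {f \<in> F. head G f = head G e}" by (auto simp: inn_def)
      then show False using key[of e] e x no deg_head[OF e(1)] dP by auto
    qed
  qed
  moreover have "\<exists>e\<in>F. head G e \<notin> P"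
  proof -
    obtain y where y: "?d P < card (inn y P)" using WP by (auto simp: W_def)
    then have "inn y P \<noteq> {}" by auto
    then obtain e where e: "e \<in> F" "head G e = y" "tail G e \<notin> P" by (auto simp: inn_def)
    show ?thesis
    proof (rule ccontr)
      assume no: "\<not> ?thesis"
      then have "out (tail G e) P = {f \<in> F. tail G f = tail G e}" by (auto simp: out_def)
      then show False using key[of e] e y no deg_tail[OF e(1)] dP by auto
    qed
  qed
  ultimately show ?thesis using that leave enter by blast
qed

section \<open>Counting arcs by pruning and splitting\<close>

text \<open>
  The truncated subtraction of \<open>M\<close> pays for the splits, as both parts of a split have support at
  least \<open>M\<close>; supports smaller than \<open>M\<close> are removed by pruning alone.
\<close>

lemma card_tight_arcs_le:
  assumes fin: "finite (arcs G)" and inj: "inj_on (arc_to_ends G) (arcs G)"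
    and D: "2 * k \<le> D" "M + k \<le> D"
    and "F \<subseteq> arcs G" and "\<And>e. e \<in> F \<Longrightarrow> \<exists>S. tight_cut G k e S"
    and "card (tail G ` F) + card (head G ` F) \<le> N"
  shows "M * card F \<le> M * D * (card (tail G ` F) + card (head G ` F))
      + k * (N + 1) * (card (tail G ` F) + card (head G ` F) - M)"
  using assms(5-)
proof (induction "card F" arbitrary: F rule: less_induct)
  case less
  let ?a = "\<lambda>F. card (tail G ` F) + card (head G ` F)"
  let ?B = "\<lambda>a. M * D * a + k * (N + 1) * (a - M)"
  have finF: "finite F" using less.prems(1) fin finite_subset by blast
  have mono: "?B a \<le> ?B b" if "a \<le> b" for a b
    using that by (intro add_mono mult_le_mono2) auto
  have sub: "M * card F' \<le> ?B b" if "F' \<subset> F" "?a F' \<le> b" for F' b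
  proof -
    have le: "card (tail G ` F') \<le> card (tail G ` F)" "card (head G ` F') \<le> card (head G ` F)"
      using finF that(1) by (auto intro!: card_mono)
    have "M * card F' \<le> ?B (?a F')"
      using less.prems le that(1) by (intro less.hyps psubset_card_mono finF) auto
    also have "\<dots> \<le> ?B b" using that(2) by (rule mono)
    finally show ?thesis .
  qed
  \<comment> \<open>The support drops by at least one, which frees \<open>M * D\<close> in the first
    term of \<open>?B\<close> and pays for at most \<open>D\<close> lost arcs.\<close>
  have prune: "M * card F \<le> ?B (?a F)" if X: "X \<subseteq> F" "X \<noteq> {}" "card X \<le> D" "?a (F - X) < ?a F" for X
  proof -
    have "card F = card (F - X) + card X"
      using X finF by (metis card_Diff_subset card_mono finite_subset le_add_diff_inverse2)
    then have "M * card F \<le> M * card (F - X) + M * D" using X(3) by (simp add: algebra_simps)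
    also have "\<dots> \<le> ?B (?a F - 1) + M * D"
      using X by (intro add_right_mono sub) auto
    also have "\<dots> \<le> ?B (?a F)"
    proof -
      obtain c where c: "?a F = Suc c" using X(4) by (cases "?a F") auto
      have "k * (N + 1) * (c - M) \<le> k * (N + 1) * (Suc c - M)" by (intro mult_le_mono2) auto
      then show ?thesis unfolding c by (simp add: algebra_simps)
    qed
    finally show ?thesis .
  qed
  consider "F = {}" | e where "e \<in> F" "card {f \<in> F. tail G f = tail G e} \<le> D"
    | e where "e \<in> F" "card {f \<in> F. head G f = head G e} \<le> D"
    | "F \<noteq> {}" "\<And>e. e \<in> F \<Longrightarrow> D < card {f \<in> F. tail G f = tail G e}"
      "\<And>e. e \<in> F \<Longrightarrow> D < card {f \<in> F. head G f = head G e}"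
    by (meson not_le)
  then show ?case
  proof cases
    case 1
    then show ?thesis by simp
  next
    case (2 e)
    let ?X = "{f \<in> F. tail G f = tail G e}"
    have "tail G e \<in> tail G ` F" "tail G e \<notin> tail G ` (F - ?X)" using 2(1) by auto
    then have "tail G ` (F - ?X) \<subset> tail G ` F" by blast
    then have "card (tail G ` (F - ?X)) < card (tail G ` F)" using finF by (intro psubset_card_mono) auto
    moreover have "card (head G ` (F - ?X)) \<le> card (head G ` F)" using finF by (intro card_mono) auto
    ultimately show ?thesis using 2 by (intro prune[of ?X]) auto
  next
    case (3 e)
    let ?X = "{f \<in> F. head G f = head G e}"
    have "head G e \<in> head G ` F" "head G e \<notin> head G ` (F - ?X)" using 3(1) by auto
    then have "head G ` (F - ?X) \<subset> head G ` F" by blast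
    then have "card (head G ` (F - ?X)) < card (head G ` F)" using finF by (intro psubset_card_mono) auto
    moreover have "card (tail G ` (F - ?X)) \<le> card (tail G ` F)" using finF by (intro card_mono) auto
    ultimately show ?thesis using 3 by (intro prune[of ?X]) auto
  next
    case 4
    have "2 * k < card {f \<in> F. tail G f = tail G e}" "2 * k < card {f \<in> F. head G f = head G e}"
      if "e \<in> F" for e using 4(2,3)[OF that] D by linarith+
    from sparse_split[OF fin inj less.prems(1) 4(1) less.prems(2) this]
    obtain P where leave: "card (leaving G F P) \<le> k"
      and enter: "card (leaving G F (- P)) \<le> k * ?a F"
      and "\<exists>e\<in>F. tail G e \<in> P" and "\<exists>e\<in>F. head G e \<notin> P" by blast
    then obtain e1 e2 where e1: "e1 \<in> F" "tail G e1 \<in> P" and e2: "e2 \<in> F" "head G e2 \<notin> P" by blast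
    let ?F1 = "{f \<in> F. tail G f \<in> P \<and> head G f \<in> P}"
    let ?F2 = "{f \<in> F. tail G f \<notin> P \<and> head G f \<notin> P}"
    let ?A1 = "card (tail G ` F \<inter> P) + card (head G ` F \<inter> P)"
    let ?A2 = "card (tail G ` F - P) + card (head G ` F - P)"
    have A: "?A1 + ?A2 = ?a F"
      using card_Int_Diff[of "tail G ` F" P] card_Int_Diff[of "head G ` F" P] finF by simp
    have finleave: "finite (leaving G F P)" using finF by (rule finite_leaving)
    \<comment> \<open>More than \<open>D\<close> arcs share the tail of \<open>e1\<close> and at
      most \<open>k\<close> of them leave \<open>P\<close>. The others, at least \<open>M\<close>,
      have distinct heads in \<open>P\<close> because parallel arcs are absent.\<close>
    have A1: "M \<le> ?A1"
    proof -
      let ?X = "{f \<in> F. tail G f = tail G e1}" and ?Y = "{f \<in> F. tail G f = tail G e1 \<and> head G f \<in> P}"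
      have "?X \<subseteq> ?Y \<union> leaving G F P" using e1 by (auto simp: leaving_def)
      then have "card ?X \<le> card (?Y \<union> leaving G F P)" using finF finleave by (intro card_mono) auto
      also have "\<dots> \<le> card ?Y + card (leaving G F P)" by (rule card_Un_le)
      finally have "M \<le> card ?Y" using 4(2)[OF e1(1)] leave D by linarith
      also have "\<dots> = card (head G ` ?Y)"
        using less.prems(1)
        by (intro card_image[symmetric] inj_onI inj_onD[OF inj]) (auto simp: arc_to_ends_def)
      also have "\<dots> \<le> card (head G ` F \<inter> P)" using finF by (intro card_mono) auto
      finally show ?thesis by simp
    qed
    have A2: "M \<le> ?A2"
    proof -
      let ?X = "{f \<in> F. head G f = head G e2}" and ?Y = "{f \<in> F. head G f = head G e2 \<and> tail G f \<notin> P}"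
      have "?X \<subseteq> ?Y \<union> leaving G F P" using e2 by (auto simp: leaving_def)
      then have "card ?X \<le> card (?Y \<union> leaving G F P)" using finF finleave by (intro card_mono) auto
      also have "\<dots> \<le> card ?Y + card (leaving G F P)" by (rule card_Un_le)
      finally have "M \<le> card ?Y" using 4(3)[OF e2(1)] leave D by linarith
      also have "\<dots> = card (tail G ` ?Y)"
        using less.prems(1)
        by (intro card_image[symmetric] inj_onI inj_onD[OF inj]) (auto simp: arc_to_ends_def)
      also have "\<dots> \<le> card (tail G ` F - P)" using finF by (intro card_mono) auto
      finally show ?thesis by simp
    qed
    \<comment> \<open>Arcs in neither part cross \<open>P\<close>. Bounding them with the fixed
      \<open>N\<close> instead of the current support keeps the charge per split constant.\<close>
    have "F \<subseteq> (?F1 \<union> ?F2) \<union> (leaving G F P \<union> leaving G F (- P))" by (auto simp: leaving_def)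
    then have "card F \<le> card ((?F1 \<union> ?F2) \<union> (leaving G F P \<union> leaving G F (- P)))"
      using finF finite_leaving[OF finF] by (intro card_mono) auto
    also have "\<dots> \<le> (card ?F1 + card ?F2) + (card (leaving G F P) + card (leaving G F (- P)))"
      by (meson add_mono card_Un_le le_trans)
    also have "\<dots> \<le> (card ?F1 + card ?F2) + (k + k * N)"
      using leave enter mult_le_mono2[OF less.prems(3), of k] by linarith
    finally have "M * card F \<le> M * card ?F1 + M * card ?F2 + k * (N + 1) * M"
      using mult_le_mono2[of "card F" _ M] by (fastforce simp: algebra_simps)
    also have "\<dots> \<le> ?B ?A1 + ?B ?A2 + k * (N + 1) * M"
    proof -
      have "?F1 \<subset> F" "?F2 \<subset> F" using e1 e2 by auto
      moreover have "?a ?F1 \<le> ?A1" "?a ?F2 \<le> ?A2"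
        using finF by (intro add_mono card_mono; auto)+
      ultimately show ?thesis using sub[of ?F1 ?A1] sub[of ?F2 ?A2] by linarith
    qed
    also have "\<dots> = M * D * (?A1 + ?A2) + k * (N + 1) * ((?A1 - M) + (?A2 - M) + M)"
      by (simp only: distrib_left add_ac)
    also have "(?A1 - M) + (?A2 - M) + M = ?a F - M" using A A1 A2 by linarith
    also have "?A1 + ?A2 = ?a F" by (rule A)
    finally show ?thesis .
  qed
qed

section \<open>Critical digraphs\<close>

text \<open>Deleting \<open>e\<close> lowers the truncated connectivity of some pair below its value
  \<open>j\<close>. By Menger, a cut of the pair has fewer than \<open>j\<close> arcs without
  \<open>e\<close> but at least \<open>j\<close> with it, hence exactly \<open>j\<close>, and
  \<open>j\<close> bounds the pair's cuts in both directions.\<close>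

lemma critical_imp_tight_cut:
  assumes "fin_digraph H" and crit: "critical k H" and e: "e \<in> arcs H"
  shows "\<exists>S. tight_cut H k e S"
proof -
  interpret H: fin_digraph H by fact
  define H' where "H' = H.del_arc e"
  interpret H': fin_digraph H' unfolding H'_def by (rule H.fin_digraph_del_arc)
  have H'_simps: "verts H' = verts H" "arcs H' = arcs H - {e}" "tail H' = tail H" "head H' = head H"
    by (simp_all add: H'_def)
  have del: "leaving H' (arcs H') Z = leaving H (arcs H) Z - {e}" for Z
    by (auto simp: leaving_def H'_simps)
  have "arcs H' \<subset> arcs H" "spanning H' H"
    using e H.subgraph_del_arc[of e] by (auto simp: H'_simps spanning_def H'_def)
  then obtain s t where st: "s \<in> verts H" "t \<in> verts H"
    and neq: "edge_conn_upto k H' s t \<noteq> edge_conn_upto k H s t"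
    using crit unfolding critical_def connectivity_preserver_def by blast
  define j where "j = edge_conn_upto k H s t"
  have flow_mono: "flow H' a b \<le> flow H a b" if ab: "a \<in> verts H" "b \<in> verts H" for a b
  proof (cases "a = b")
    case True
    then show ?thesis using ab by (simp add: H.flow_refl H'.flow_refl H'_simps)
  next
    case False
    obtain Z where Z: "a \<in> Z" "b \<notin> Z" "card (leaving H (arcs H) Z) \<le> flow H a b"
      by (rule H.ex_cut_le_flow[OF ab False])
    have "flow H' a b \<le> card (leaving H (arcs H) Z - {e})"
      using H'.flow_le_cut[OF Z(1,2)] by (simp only: del)
    also have "\<dots> \<le> card (leaving H (arcs H) Z)" by (rule card_Diff1_le)
    finally show ?thesis using Z(3) by linarith
  qed
  have "s \<noteq> t"
    using neq st by (auto simp: edge_conn_upto_def edge_conn_def H.flow_refl H'.flow_refl H'_simps)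
  have j: "j \<le> k" "j \<le> flow H s t" "j \<le> flow H t s"
    by (auto simp: j_def edge_conn_upto_def edge_conn_def)
  have "edge_conn_upto k H' s t \<le> j"
    unfolding j_def edge_conn_upto_def edge_conn_def
    by (intro min.mono flow_mono st order_refl)
  with neq have "edge_conn_upto k H' s t < j" by (simp add: j_def)
  then have drop: "flow H' s t < j \<or> flow H' t s < j"
    using j(1) by (auto simp: edge_conn_upto_def edge_conn_def)
  have ge: "j \<le> card (leaving H (arcs H) Z)" if "(s \<in> Z) \<noteq> (t \<in> Z)" for Z
    using that H.flow_le_cut[of s Z t] H.flow_le_cut[of t Z s] j by fastforce
  \<comment> \<open>\<open>a\<close> and \<open>b\<close> are \<open>s\<close> and \<open>t\<close>
    in the order in which the flow drops. The bound \<open>ge\<close> is symmetric and survives the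
    renaming.\<close>
  obtain a b where ab: "{a, b} = {s, t}" "flow H' a b < j" using drop by blast
  then have "a \<in> verts H'" "b \<in> verts H'" "a \<noteq> b"
    using \<open>s \<noteq> t\<close> st by (auto simp: H'_simps doubleton_eq_iff)
  then obtain S where S: "a \<in> S" "b \<notin> S" "card (leaving H' (arcs H') S) \<le> flow H' a b"
    by (rule H'.ex_cut_le_flow)
  have lt: "card (leaving H (arcs H) S - {e}) < j"
    using S(3) ab(2) unfolding del by linarith
  have "(s \<in> S) \<noteq> (t \<in> S)" using ab(1) S(1,2) by (auto simp: doubleton_eq_iff)
  from ge[OF this] have le: "j \<le> card (leaving H (arcs H) S)" .
  have eS: "e \<in> leaving H (arcs H) S" using le lt by (metis Diff_empty Diff_insert0 not_le)
  then have card_S: "card (leaving H (arcs H) S) = j"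
    using le lt finite_leaving[OF H.finite_arcs, of H S] by (simp add: card_Diff_singleton)
  have "\<forall>Z. (a \<in> Z) \<noteq> (b \<in> Z) \<longrightarrow> j \<le> card (leaving H (arcs H) Z)"
  proof (intro allI impI ge)
    fix Z assume "(a \<in> Z) \<noteq> (b \<in> Z)"
    then show "(s \<in> Z) \<noteq> (t \<in> Z)" using ab(1) by (auto simp: doubleton_eq_iff)
  qed
  then have "\<exists>s t. s \<in> S \<and> t \<notin> S \<and> (\<forall>Z. (s \<in> Z) \<noteq> (t \<in> Z) \<longrightarrow> j \<le> card (leaving H (arcs H) Z))"
    using S(1,2) by (intro exI[of _ a] exI[of _ b] conjI)
  then have "tight_cut H k e S" using eS j(1) by (simp only: tight_cut_def card_S simp_thms)
  then show ?thesis ..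
qed

section \<open>Choice of parameters\<close>

theorem theorem5p3:
  shows "\<exists>C::real. 0 < C \<and>
    (\<forall>(k::nat) (H::('a, 'b) pre_digraph).
       0 < k \<longrightarrow> fin_digraph H \<longrightarrow> nomulti_digraph H \<longrightarrow> critical k H \<longrightarrow>
       real (card (arcs H)) \<le> C * real k powr (1/2) * real (card (verts H)) powr (3/2))"
\<comment> \<open>For \<open>k \<le> n\<close> pruning contributes \<open>8 * n * r\<close> and
  splitting \<open>6 * n * r\<close>, which \<open>18\<close> covers.\<close>
proof (intro exI[of _ "18::real"] conjI allI impI)
  fix k :: nat and H :: "('a, 'b) pre_digraph"
  assume k: "0 < k" and "fin_digraph H" "nomulti_digraph H" and crit: "critical k H"
  interpret H: fin_digraph H by fact
  interpret N: nomulti_digraph H by fact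
  define n where "n = card (verts H)"
  define r where "r = sqrt (real k * real n)"
  have goal: "18 * real k powr (1/2) * real n powr (3/2) = 18 * (real n * r)"
  proof (cases "n = 0")
    case False
    have "real n powr (3/2) = real n powr 1 * real n powr (1/2)" by (subst powr_add[symmetric]) simp
    then show ?thesis by (simp add: r_def powr_half_sqrt real_sqrt_mult)
  qed simp
  have card_sq: "card (arcs H) \<le> n * n"
  proof -
    have "card (arcs H) \<le> card (verts H \<times> verts H)"
      using N.inj_on_arc_to_ends by (rule card_inj_on_le) (auto simp: arc_to_ends_def)
    then show ?thesis by (simp add: n_def card_cartesian_product)
  qed
  have "real (card (arcs H)) \<le> 18 * (real n * r)"
  proof (cases "k \<le> n")
    case False
    \<comment> \<open>Here \<open>n \<le> r\<close>, so the trivial bound \<open>n * n\<close>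
      suffices.\<close>
    then have "real n * real n \<le> real k * real n" by (intro mult_right_mono) auto
    then have "real n \<le> r" unfolding r_def by (intro real_le_rsqrt) (simp add: power2_eq_square)
    then have "real n * real n \<le> real n * r" by (intro mult_left_mono) auto
    moreover have "real (card (arcs H)) \<le> real n * real n" using card_sq by (metis of_nat_le_iff of_nat_mult)
    moreover have "0 \<le> real n * r" by (simp add: r_def)
    ultimately show ?thesis by linarith
  next
    case True
    \<comment> \<open>With \<open>D = M + k\<close>, pruning costs order \<open>n * D\<close> and
      splitting order \<open>k * n * n / M\<close>; these balance for \<open>M\<close> of order
      \<open>r\<close>. The summand \<open>k\<close> ensures \<open>2 * k \<le> D\<close>.\<close>
    define M where "M = nat \<lceil>r\<rceil> + k"
    have kr: "real k \<le> r"
      unfolding r_def using True by (intro real_le_rsqrt) (simp add: power2_eq_square mult_left_mono)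
    have r1: "1 \<le> r" using kr k by linarith
    have M: "r \<le> real M" "real M \<le> r + 1 + real k" using r1 unfolding M_def by linarith+
    let ?a = "card (tail H ` arcs H) + card (head H ` arcs H)"
    have a: "?a \<le> 2 * n"
    proof -
      have "card (tail H ` arcs H) \<le> n" "card (head H ` arcs H) \<le> n"
        unfolding n_def by (intro card_mono; auto)+
      then show ?thesis by simp
    qed
    have "M * card (arcs H) \<le> M * (M + k) * ?a + k * (2 * n + 1) * (?a - M)"
      using a critical_imp_tight_cut[OF \<open>fin_digraph H\<close> crit]
      by (intro card_tight_arcs_le[OF H.finite_arcs N.inj_on_arc_to_ends]) (auto simp: M_def)
    also have "\<dots> \<le> M * (M + k) * (2 * n) + k * (3 * n) * (2 * n)"
      using a True k by (intro add_mono mult_le_mono) auto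
    finally have "real (M * card (arcs H)) \<le> real (M * (M + k) * (2 * n) + k * (3 * n) * (2 * n))"
      by (rule of_nat_mono)
    then have 1: "real M * real (card (arcs H)) \<le>
      real M * (real M + real k) * (2 * real n) + 6 * real n * (real k * real n)"
      by (simp add: algebra_simps)
    \<comment> \<open>Exposes a factor \<open>M\<close> in the splitting term, so that
      \<open>M\<close> cancels.\<close>
    have "real k * real n = r * r" by (simp add: r_def)
    also have "\<dots> \<le> real M * r" using M r1 by (intro mult_right_mono) auto
    finally have "6 * real n * (real k * real n) \<le> 6 * real n * (real M * r)"
      by (intro mult_left_mono) auto
    then have "real M * real (card (arcs H)) \<le> real M * ((real M + real k) * (2 * real n) + 6 * real n * r)"
      using 1 by (simp add: algebra_simps)
    then have "real (card (arcs H)) \<le> (real M + real k) * (2 * real n) + 6 * real n * r"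
      using M r1 by (subst (asm) mult_le_cancel_left_pos) auto
    also have "(real M + real k) * (2 * real n) \<le> (4 * r) * (2 * real n)"
      using M kr r1 by (intro mult_right_mono) auto
    finally show ?thesis by (simp add: algebra_simps)
  qed
  then show "real (card (arcs H)) \<le> 18 * real k powr (1/2) * real (card (verts H)) powr (3/2)"
    using goal by (simp add: n_def)
qed simp

end
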